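(* Let $n\ge 2$ and let $\mathbf b=(b_1,\dots,b_n)\in\mathbb Z_{>0}^n$, with $S_i=b_1+\cdots+b_i$ for $0\le i\le n$ ($S_0=0$). Let $h$ be an integer with $1\le h\le S_n$, and write $h=S_{\ell-1}+r$ with integers $1\le \ell\le n$ and $1\le r\le b_\ell$ (equivalently $S_{\ell-1}<h\le S_\ell$). Then the layer of $\mathfrak X_n(\mathbf b)$ at height $h$ satisfies $\mathfrak X_n(\mathbf b)[h]=\mathfrak X_{n-1}(\mathbf b')$, where $\mathbf b'\in\mathbb Z_{>0}^{n-1}$ is given by $$\mathbf b'=\begin{cases}(b_1+b_2,\ b_3,\dots,b_n), & \ell=1,\\ (b_1,\dots,b_{\ell-2},\ b_{\ell-1}+b_\ell-r,\ b_{\ell+1}+r,\ b_{\ell+2},\dots,b_n), & 1<\ell<n,\\ (b_1,\dots,b_{n-2},\ b_{n-1}+b_n-r), & \ell=n.\end{cases}$$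
   Context: For $\mathbf b=(b_1,\dots,b_n)\in\mathbb Z_{>0}^n$, a $\mathbf b$-parking function is a list $(\beta_1,\dots,\beta_n)$ of positive integers whose nondecreasing rearrangement $\beta_1'\le\cdots\le\beta_n'$ satisfies $\beta_i'\le b_1+\cdots+b_i$ for all $i$. The $\mathbf b$-parking-function polytope $\mathfrak X_n(\mathbf b)\subset\mathbb R^n$ is the convex hull of all $\mathbf b$-parking functions of length $n$. The layer at height $h$ is $\mathfrak X_n(\mathbf b)[h]:=\{(x_1,\dots,x_{n-1})\in\mathbb R^{n-1}:(x_1,\dots,x_{n-1},h)\in\mathfrak X_n(\mathbf b)\}$. *)

theory Defs
  imports "HOL-Analysis.Analysis" "HOL-Analysis.Finite_Function_Topology"
begin

(* Lists are 0-indexed: the entry b_i of the vector b = (b_1,...,b_n) is b ! (i - 1).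
   partial_sum b i is S_i = b_1 + ... + b_i, for 0 <= i <= n. *)
definition partial_sum :: "nat list \<Rightarrow> nat \<Rightarrow> nat" where
  "partial_sum b i = sum_list (take i b)"

definition parking_function :: "nat list \<Rightarrow> nat list \<Rightarrow> bool" where
  "parking_function b \<beta> \<longleftrightarrow>
     length \<beta> = length b \<and> (\<forall>x\<in>set \<beta>. 0 < x) \<and>
     (\<forall>i\<in>{1..length b}. sort \<beta> ! (i - 1) \<le> partial_sum b i)"

(* A point (x_1,...,x_n) of R^n is the finitely supported function x :: nat =>0 real with
   coordinates x_i = lookup x (i - 1) and support inside {..<n}. The finitely supported
   functions are a real vector space, so the library's convex hull applies uniformly in n. *)
definition real_space :: "nat \<Rightarrow> (nat \<Rightarrow>\<^sub>0 real) set" where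
  "real_space n = {x. Poly_Mapping.keys x \<subseteq> {..<n}}"

(* Poly_Mapping.nth turns a list of length n into the point of R^n with these coordinates. *)
definition parking_polytope :: "nat list \<Rightarrow> (nat \<Rightarrow>\<^sub>0 real) set" where
  "parking_polytope b =
     convex hull {Poly_Mapping.nth (map real \<beta>) |\<beta>. parking_function b \<beta>}"

(* For x = (x_1,...,x_{n-1}) in R^(n-1), the updated function is (x_1,...,x_{n-1},h) in R^n. *)
definition layer :: "nat \<Rightarrow> (nat \<Rightarrow>\<^sub>0 real) set \<Rightarrow> real \<Rightarrow> (nat \<Rightarrow>\<^sub>0 real) set" where
  "layer n P h = {x \<in> real_space (n - 1). Poly_Mapping.update (n - 1) h x \<in> P}"

definition height_decomposition :: "nat list \<Rightarrow> nat \<Rightarrow> nat \<Rightarrow> nat \<Rightarrow> bool" where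
  "height_decomposition b h l r \<longleftrightarrow>
     1 \<le> l \<and> l \<le> length b \<and> 1 \<le> r \<and> r \<le> b ! (l - 1) \<and> h = partial_sum b (l - 1) + r"

(* The natural-number subtractions of r do not truncate, as r <= b_l. *)
definition reduced_vector :: "nat list \<Rightarrow> nat \<Rightarrow> nat \<Rightarrow> nat list" where
  "reduced_vector b l r =
     (let n = length b in
      if l = 1 then (b ! 0 + b ! 1) # drop 2 b
      else if l < n then
        take (l - 2) b @ [b ! (l - 2) + b ! (l - 1) - r, b ! l + r] @ drop (l + 1) b
      else take (n - 2) b @ [b ! (n - 2) + b ! (n - 1) - r])"

end

theory Submission
  imports Defs "HOL-Combinatorics.List_Permutation"
begin

text \<open>
  Put $S_i = b_1 + \dots + b_i$. A list is a parking function for \<open>b\<close> exactly when some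
  permutation \<open>\<sigma>\<close> satisfies $1 \le \beta_i \le S_{\sigma(i)}$ for all $i$, so the polytope is the
  convex hull of the union of the boxes $\prod_i [1, S_{\sigma(i)}]$. In this form the numbers $S_i$
  need not be integers, and the whole argument is carried out for a nondecreasing real sequence
  $S$ with $S_1 \ge 1$. This freedom is essential: the layers at non-integral heights have the same
  shape, and they enter the induction below.

  Two descriptions are played against each other. The hull satisfies the inequalities $x_i \ge 1$
  and $\sum_{i \in A} x_i \le T_{|A|}$ for every $A$, where $T_k$ is the sum of the $k$ largest
  $S_i$. If $x$ satisfies them and has last coordinate $h$, then applying them to $A$ and to
  $A \cup \{n\}$ bounds the first $n - 1$ coordinates by $\min(T_k, T_{k+1} - h)$, $k = |A|$. These
  minima are again sums of the $k$ largest entries of a sequence of length $n - 1$, called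
  \<open>slice S h\<close> below (\<open>layer_subset_sum_polytope\<close>). Conversely, a point of a permuted box for
  \<open>slice S h\<close>, extended by the coordinate $h$, lies on a segment between two points of permuted
  boxes for $S$: if $S_m \le h \le S_{m+1}$, they have last coordinates $S_m$ and $S_{m+1}$,
  and if $h < S_1$, the extended point lies in a permuted box itself
  (\<open>permuted_boxes_slice_subset_layer\<close>).

  Together these two inclusions show by induction on $n$ that the inequalities describe the hull
  (\<open>hull_permuted_boxes\<close>): a point satisfying them lies in the layer through its own last
  coordinate, where the induction hypothesis applies. Once both descriptions agree, the same two
  inclusions say that the layer at height $h$ is the polytope of \<open>slice S h\<close>. Finally, for
  $h = S_{\ell-1} + r$ the sequence \<open>slice S h\<close> is
  $S_1, \dots, S_{\ell-2}, S_\ell - r, S_{\ell+1}, \dots, S_n$ (just $S_2, \dots, S_n$ if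
  $\ell = 1$), which are the partial sums of the reduced vector.
\<close>

section \<open>Points of the ambient space\<close>

definition point :: "nat \<Rightarrow> (nat \<Rightarrow> real) \<Rightarrow> (nat \<Rightarrow>\<^sub>0 real)" where
  "point n f = Poly_Mapping.nth (map f [0..<n])"

lemma lookup_point: "Poly_Mapping.lookup (point n f) i = (if i < n then f i else 0)"
  by (simp add: point_def nth_default_def)

lemma lookup_scaleR:
  fixes x :: "nat \<Rightarrow>\<^sub>0 real"
  shows "Poly_Mapping.lookup (r *\<^sub>R x) i = r * Poly_Mapping.lookup x i"
proof -
  have "{i. r * Poly_Mapping.lookup x i \<noteq> 0} \<subseteq> {i. Poly_Mapping.lookup x i \<noteq> 0}"
    by auto
  then have "finite {i. r * Poly_Mapping.lookup x i \<noteq> 0}"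
    using finite_lookup finite_subset by blast
  then show ?thesis
    unfolding scaleR_poly_mapping_def by simp
qed

lemma real_space_iff: "x \<in> real_space n \<longleftrightarrow> (\<forall>i\<ge>n. Poly_Mapping.lookup x i = 0)"
  by (auto simp: real_space_def in_keys_iff subset_iff not_less) (meson not_less)

lemma point_in_real_space: "point n f \<in> real_space n"
  by (simp add: real_space_iff lookup_point)

lemma point_lookup: "x \<in> real_space n \<Longrightarrow> point n (Poly_Mapping.lookup x) = x"
  by (rule poly_mapping_eqI) (auto simp: real_space_iff lookup_point)

lemma convex_real_space: "convex (real_space n)"
  by (auto simp: convex_def real_space_iff lookup_add lookup_scaleR)

lemma convex_layer:
  assumes "convex P"
  shows "convex (layer n P h)"
proof (rule convexI)
  fix x y and u v :: real
  assume x: "x \<in> layer n P h" and y: "y \<in> layer n P h" and uv: "0 \<le> u" "0 \<le> v" "u + v = 1"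
  have "Poly_Mapping.update (n - 1) h (u *\<^sub>R x + v *\<^sub>R y)
      = u *\<^sub>R Poly_Mapping.update (n - 1) h x + v *\<^sub>R Poly_Mapping.update (n - 1) h y"
    using uv by (intro poly_mapping_eqI)
      (auto simp: lookup_update lookup_add lookup_scaleR simp flip: distrib_right)
  then show "u *\<^sub>R x + v *\<^sub>R y \<in> layer n P h"
    using x y uv convexD[OF assms] convexD[OF convex_real_space] by (auto simp: layer_def)
qed

lemma update_lookup_in_layer:
  assumes "x \<in> real_space (Suc n)" "x \<in> P"
  shows "Poly_Mapping.update n 0 x \<in> layer (Suc n) P (Poly_Mapping.lookup x n)"
proof -
  have "Poly_Mapping.update n (Poly_Mapping.lookup x n) (Poly_Mapping.update n 0 x) = x"
    by (rule poly_mapping_eqI) (simp add: lookup_update)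
  then show ?thesis
    using assms by (auto simp: layer_def real_space_iff lookup_update)
qed

lemma between_convex_combination:
  fixes a b x :: real
  assumes "a \<le> x" "x \<le> b"
  shows "\<exists>t. 0 \<le> t \<and> t \<le> 1 \<and> x = (1 - t) * a + t * b"
proof -
  have "x \<in> closed_segment a b"
    using assms by (simp add: closed_segment_eq_real_ivl)
  then show ?thesis by (auto simp: in_segment)
qed

text \<open>
  Moving one coordinate at a time to the ends of its interval reaches the corners, so a box lies in
  the convex hull of its corners. The induction counts the coordinates that are not yet known to be
  at an end.
\<close>

lemma box_subset_convex:
  assumes "convex C"
    and corners: "\<And>f. (\<And>i. i < n \<Longrightarrow> f i = a i \<or> f i = b i) \<Longrightarrow> point n f \<in> C"
    and f: "\<And>i. i < n \<Longrightarrow> a i \<le> f i \<and> f i \<le> b i"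
  shows "point n f \<in> C"
proof -
  have "\<forall>f. (\<forall>i<n. a i \<le> f i \<and> f i \<le> b i) \<longrightarrow> (\<forall>i<n. k \<le> i \<longrightarrow> f i = a i \<or> f i = b i)
    \<longrightarrow> point n f \<in> C" if "k \<le> n" for k
    using that
  proof (induction k)
    case 0
    then show ?case using corners by auto
  next
    case (Suc k)
    show ?case
    proof (intro allI impI)
      fix f
      assume f: "\<forall>i<n. a i \<le> f i \<and> f i \<le> b i"
        and ex: "\<forall>i<n. Suc k \<le> i \<longrightarrow> f i = a i \<or> f i = b i"
      have k: "k < n" using Suc by simp
      have fk: "a k \<le> f k" "f k \<le> b k" using f k by auto
      then obtain t where t: "0 \<le> t" "t \<le> 1" "f k = (1 - t) * a k + t * b k"
        using between_convex_combination by blast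
      have ends: "point n (f(k := c)) \<in> C" if c: "c = a k \<or> c = b k" for c
      proof -
        have "a i \<le> (f(k := c)) i \<and> (f(k := c)) i \<le> b i" if "i < n" for i
          using f fk c that by (cases "i = k") auto
        moreover have "(f(k := c)) i = a i \<or> (f(k := c)) i = b i" if "i < n" "k \<le> i" for i
          using ex c that by (cases "i = k") auto
        ultimately show ?thesis using Suc.IH[OF less_imp_le[OF k]] by blast
      qed
      have eq: "point n f = (1 - t) *\<^sub>R point n (f(k := a k)) + t *\<^sub>R point n (f(k := b k))"
      proof (rule poly_mapping_eqI)
        fix i
        show "Poly_Mapping.lookup (point n f) i = Poly_Mapping.lookup
            ((1 - t) *\<^sub>R point n (f(k := a k)) + t *\<^sub>R point n (f(k := b k))) i"
          using t(3) by (cases "i = k")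
            (simp_all add: lookup_point lookup_add lookup_scaleR left_diff_distrib)
      qed
      show "point n f \<in> C"
        unfolding eq by (rule convexD_alt[OF assms(1) ends ends t(1,2)]) simp_all
    qed
  qed
  from this[of n] show ?thesis using f by auto
qed

section \<open>Permuted boxes and their inequality description\<close>

text \<open>
  With $0$-based indices \<open>S i\<close> stands for $S_{i+1}$. An injection of \<open>{..<n}\<close> into itself is a
  permutation; this form spares fixing the values of \<open>\<sigma>\<close> outside \<open>{..<n}\<close>.
\<close>

definition permuted_boxes :: "nat \<Rightarrow> (nat \<Rightarrow> real) \<Rightarrow> (nat \<Rightarrow>\<^sub>0 real) set" where
  "permuted_boxes n S = {x \<in> real_space n. \<exists>\<sigma>. inj_on \<sigma> {..<n} \<and>
     (\<forall>i<n. \<sigma> i < n \<and> 1 \<le> Poly_Mapping.lookup x i \<and> Poly_Mapping.lookup x i \<le> S (\<sigma> i))}"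

text \<open>
  For nondecreasing \<open>S\<close> the right-hand side is the sum of the \<open>card A\<close> largest values, so this is the
  part above $(1, \dots, 1)$ of a polymatroid that is symmetric under coordinate permutations.
\<close>

definition subset_sum_polytope :: "nat \<Rightarrow> (nat \<Rightarrow> real) \<Rightarrow> (nat \<Rightarrow>\<^sub>0 real) set" where
  "subset_sum_polytope n S = {x \<in> real_space n. (\<forall>i<n. 1 \<le> Poly_Mapping.lookup x i) \<and>
     (\<forall>A\<subseteq>{..<n}. sum (Poly_Mapping.lookup x) A \<le> sum S {n - card A..<n})}"

lemma permuted_boxes_cong:
  assumes "\<And>i. i < n \<Longrightarrow> S i = T i"
  shows "permuted_boxes n S = permuted_boxes n T"
  unfolding permuted_boxes_def using assms by (intro Collect_cong conj_cong ex_cong1) auto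

lemma convex_subset_sum_polytope: "convex (subset_sum_polytope n S)"
proof (rule convexI)
  fix x y and u v :: real
  assume x: "x \<in> subset_sum_polytope n S" and y: "y \<in> subset_sum_polytope n S"
    and uv: "0 \<le> u" "0 \<le> v" "u + v = 1"
  have "1 \<le> Poly_Mapping.lookup (u *\<^sub>R x + v *\<^sub>R y) i" if "i < n" for i
  proof -
    have "1 \<le> Poly_Mapping.lookup x i" "1 \<le> Poly_Mapping.lookup y i"
      using x y that by (auto simp: subset_sum_polytope_def)
    then show ?thesis
      using convex_bound_le[of "- Poly_Mapping.lookup x i" "-1" "- Poly_Mapping.lookup y i" u v] uv
      by (simp add: lookup_add lookup_scaleR)
  qed
  moreover have "sum (Poly_Mapping.lookup (u *\<^sub>R x + v *\<^sub>R y)) A \<le> sum S {n - card A..<n}"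
    if "A \<subseteq> {..<n}" for A
  proof -
    have "sum (Poly_Mapping.lookup (u *\<^sub>R x + v *\<^sub>R y)) A
        = u * sum (Poly_Mapping.lookup x) A + v * sum (Poly_Mapping.lookup y) A"
      by (simp add: lookup_add lookup_scaleR sum.distrib sum_distrib_left)
    also have "\<dots> \<le> sum S {n - card A..<n}"
      using x y that uv by (intro convex_bound_le) (auto simp: subset_sum_polytope_def)
    finally show ?thesis .
  qed
  moreover have "u *\<^sub>R x + v *\<^sub>R y \<in> real_space n"
    using x y uv convexD[OF convex_real_space] by (auto simp: subset_sum_polytope_def)
  ultimately show "u *\<^sub>R x + v *\<^sub>R y \<in> subset_sum_polytope n S"
    by (auto simp: subset_sum_polytope_def)
qed

lemma sum_le_sum_largest:
  fixes S :: "nat \<Rightarrow> real"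
  assumes "mono_on {..<n} S" "B \<subseteq> {..<n}"
  shows "sum S B \<le> sum S {n - card B..<n}"
  using assms
proof (induction n arbitrary: B)
  case 0
  then show ?case by simp
next
  case (Suc n)
  have mono: "mono_on {..<n} S"
    using Suc.prems(1) by (rule mono_on_subset) auto
  have fin: "finite B" using Suc.prems(2) finite_subset by blast
  show ?case
  proof (cases "n \<in> B")
    case True
    have sub: "B - {n} \<subseteq> {..<n}" using Suc.prems(2) by (auto simp: less_Suc_eq)
    define k where "k = card (B - {n})"
    have card: "card B = Suc k"
      unfolding k_def using True fin by (metis card_Suc_Diff1)
    have "sum S B = S n + sum S (B - {n})"
      using True fin by (simp add: sum.remove)
    also have "\<dots> \<le> S n + sum S {n - k..<n}"
      using Suc.IH[OF mono sub] unfolding k_def by linarith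
    also have "\<dots> = sum S {Suc n - card B..<Suc n}"
      by (simp add: card)
    finally show ?thesis .
  next
    case False
    then have sub: "B \<subseteq> {..<n}" using Suc.prems(2) by (auto simp: less_Suc_eq)
    then have le: "card B \<le> n" using card_mono[OF _ sub] by simp
    have "sum S B \<le> sum S {n - card B..<n}"
      by (rule Suc.IH[OF mono sub])
    also have "\<dots> \<le> (\<Sum>i = n - card B..<n. S (Suc i))"
      using Suc.prems(1) by (intro sum_mono) (auto simp: mono_on_def)
    also have "\<dots> = sum S {Suc n - card B..<Suc n}"
      using le by (simp add: sum.shift_bounds_Suc_ivl[symmetric] Suc_diff_le del: sum.op_ivl_Suc)
    finally show ?thesis .
  qed
qed

text \<open>
  On a box for \<open>\<sigma>\<close> the coordinates in \<open>A\<close> are bounded by entries of \<open>S\<close> with distinct indices, hence their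
  sum by that of the largest ones.
\<close>

lemma hull_permuted_boxes_subset:
  assumes "mono_on {..<n} S"
  shows "convex hull (permuted_boxes n S) \<subseteq> subset_sum_polytope n S"
proof (rule hull_minimal)
  show "permuted_boxes n S \<subseteq> subset_sum_polytope n S"
  proof
    fix x assume "x \<in> permuted_boxes n S"
    then obtain \<sigma> where x: "x \<in> real_space n" and inj: "inj_on \<sigma> {..<n}"
      and \<sigma>: "\<And>i. i < n \<Longrightarrow> \<sigma> i < n \<and> 1 \<le> Poly_Mapping.lookup x i \<and> Poly_Mapping.lookup x i \<le> S (\<sigma> i)"
      by (auto simp: permuted_boxes_def)
    have "sum (Poly_Mapping.lookup x) A \<le> sum S {n - card A..<n}" if A: "A \<subseteq> {..<n}" for A
    proof -
      have injA: "inj_on \<sigma> A" using inj A by (rule inj_on_subset)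
      have "sum (Poly_Mapping.lookup x) A \<le> (\<Sum>i\<in>A. S (\<sigma> i))"
        using \<sigma> A by (intro sum_mono) auto
      also have "\<dots> = sum S (\<sigma> ` A)"
        using injA by (simp add: sum.reindex)
      also have "\<dots> \<le> sum S {n - card (\<sigma> ` A)..<n}"
        using assms \<sigma> A by (intro sum_le_sum_largest) auto
      finally show ?thesis using injA by (simp add: card_image)
    qed
    then show "x \<in> subset_sum_polytope n S"
      using x \<sigma> by (auto simp: subset_sum_polytope_def)
  qed
qed (rule convex_subset_sum_polytope)

section \<open>Layers\<close>

text \<open>
  For nondecreasing \<open>S\<close> this is \<open>S (Suc i)\<close> if \<open>h \<le> S i\<close>, it is \<open>S i\<close> if \<open>S (Suc i) \<le> h\<close>, and it is
  \<open>S i + S (Suc i) - h\<close> in between. Writing it with minima avoids the case distinction and makes its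
  sums telescope.
\<close>

definition slice :: "(nat \<Rightarrow> real) \<Rightarrow> real \<Rightarrow> nat \<Rightarrow> real" where
  "slice S h i = S (Suc i) - min h (S (Suc i)) + min h (S i)"

lemma mono_on_slice:
  assumes "mono_on {..<Suc n} S"
  shows "mono_on {..<n} (slice S h)"
proof (rule mono_onI)
  fix i j assume ij: "i \<in> {..<n}" "j \<in> {..<n}" "i \<le> j"
  have "S i \<le> S j" "S (Suc i) \<le> S (Suc j)"
    using ij assms by (auto simp: mono_on_def)
  then show "slice S h i \<le> slice S h j"
    by (auto simp: slice_def min_def)
qed

lemma slice_ge_one:
  assumes "1 \<le> h" "1 \<le> S i" "1 \<le> S (Suc i)"
  shows "1 \<le> slice S h i"
  using assms by (auto simp: slice_def min_def)

text \<open>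
  The sum telescopes. With $k = n - j$ and \<open>h \<le> S n\<close>, the right-hand side is
  $\min(T_k, T_{k+1} - h)$ for the sums $T_k$ of the $k$ largest among \<open>S 0, \<dots>, S n\<close>.
\<close>

lemma sum_slice:
  assumes "j \<le> n"
  shows "sum (slice S h) {j..<n} = sum S {Suc j..<Suc n} - min h (S n) + min h (S j)"
  using assms by (induction n rule: dec_induct) (auto simp: slice_def)

text \<open>
  The inequality for \<open>A\<close> alone ignores the fixed last coordinate, the one for \<open>insert n A\<close> makes use
  of it; the smaller of the two bounds is the one in \<open>sum_slice\<close>.
\<close>

lemma layer_subset_sum_polytope:
  assumes "h \<le> S n"
  shows "layer (Suc n) (subset_sum_polytope (Suc n) S) h \<subseteq> subset_sum_polytope n (slice S h)"
proof
  fix x assume "x \<in> layer (Suc n) (subset_sum_polytope (Suc n) S) h"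
  then have x: "x \<in> real_space n"
    and ge: "\<And>i. i < Suc n \<Longrightarrow> 1 \<le> Poly_Mapping.lookup (Poly_Mapping.update n h x) i"
    and le: "\<And>A. A \<subseteq> {..<Suc n} \<Longrightarrow> sum (Poly_Mapping.lookup (Poly_Mapping.update n h x)) A
        \<le> sum S {Suc n - card A..<Suc n}"
    by (auto simp: layer_def subset_sum_polytope_def)
  have "1 \<le> Poly_Mapping.lookup x i" if "i < n" for i
    using ge[of i] that by (simp add: lookup_update)
  moreover have "sum (Poly_Mapping.lookup x) A \<le> sum (slice S h) {n - card A..<n}"
    if A: "A \<subseteq> {..<n}" for A
  proof -
    have fin: "finite A" and nA: "n \<notin> A" using A finite_subset by auto
    have card: "card A \<le> n" using card_mono[OF _ A] by simp
    define j where "j = n - card A"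
    have j: "j \<le> n" "Suc n - card A = Suc j" using card by (auto simp: j_def)
    have eq: "sum (Poly_Mapping.lookup (Poly_Mapping.update n h x)) A = sum (Poly_Mapping.lookup x) A"
      using nA by (intro sum.cong) (auto simp: lookup_update)
    have "sum (Poly_Mapping.lookup x) A \<le> sum S {Suc j..<Suc n}"
    proof -
      have "A \<subseteq> {..<Suc n}" using A by auto
      from le[OF this] show ?thesis unfolding eq j .
    qed
    moreover have "h + sum (Poly_Mapping.lookup x) A \<le> sum S {j..<Suc n}"
    proof -
      have "insert n A \<subseteq> {..<Suc n}" using A by auto
      from le[OF this] show ?thesis
        using fin nA eq j by (simp add: lookup_update j_def del: sum.op_ivl_Suc)
    qed
    moreover have "sum S {j..<Suc n} = S j + sum S {Suc j..<Suc n}"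
      using j by (simp add: sum.atLeast_Suc_lessThan del: sum.op_ivl_Suc)
    ultimately show ?thesis
      using j assms by (simp add: sum_slice j_def[symmetric] min_def del: sum.op_ivl_Suc)
  qed
  ultimately show "x \<in> subset_sum_polytope n (slice S h)"
    using x by (auto simp: subset_sum_polytope_def)
qed

text \<open>
  The increasing enumeration of the indices other than \<open>m\<close>, so that \<open>\<lambda>j. S (skip m j)\<close> is \<open>S\<close> with
  its entry \<open>m\<close> removed.
\<close>

definition skip :: "nat \<Rightarrow> nat \<Rightarrow> nat" where
  "skip m j = (if j < m then j else Suc j)"

text \<open>
  If the last coordinate takes the bound \<open>S m\<close>, the others share the remaining entries of \<open>S\<close>.
\<close>

lemma update_in_permuted_boxes:
  assumes y: "y \<in> permuted_boxes n (\<lambda>j. S (skip m j))" and "m \<le> n" "1 \<le> h" "h \<le> S m"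
  shows "Poly_Mapping.update n h y \<in> permuted_boxes (Suc n) S"
proof -
  obtain \<sigma> where inj: "inj_on \<sigma> {..<n}" and ys: "y \<in> real_space n"
    and \<sigma>: "\<And>i. i < n \<Longrightarrow> \<sigma> i < n \<and> 1 \<le> Poly_Mapping.lookup y i
        \<and> Poly_Mapping.lookup y i \<le> S (skip m (\<sigma> i))"
    using y by (auto simp: permuted_boxes_def)
  define \<tau> where "\<tau> i = (if i < n then skip m (\<sigma> i) else m)" for i
  have skip: "skip m i \<noteq> m" "skip m i = skip m j \<longleftrightarrow> i = j" for i j
    by (auto simp: skip_def)
  have "inj_on \<tau> {..<Suc n}"
    using inj by (auto simp: inj_on_def \<tau>_def skip less_Suc_eq) (metis skip(1))+
  moreover have "\<tau> i < Suc n \<and> 1 \<le> Poly_Mapping.lookup (Poly_Mapping.update n h y) i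
      \<and> Poly_Mapping.lookup (Poly_Mapping.update n h y) i \<le> S (\<tau> i)" if "i < Suc n" for i
    using that assms \<sigma>[of i] by (auto simp: \<tau>_def lookup_update skip_def less_Suc_eq)
  ultimately show ?thesis
    using ys unfolding permuted_boxes_def mem_Collect_eq
    by (intro conjI exI[of _ \<tau>]) (auto simp: real_space_iff lookup_update)
qed

text \<open>
  Both intervals start at \<open>1\<close>, so \<open>u\<close> and \<open>v\<close> may be placed at the same relative position in
  \<open>{1..a}\<close> and \<open>{1..b}\<close> as \<open>y\<close> in the interval from \<open>1\<close> to \<open>(1 - t) * a + t * b\<close>. If the latter is
  a single point, the division by zero gives \<open>s = 0\<close>, which is right.
\<close>

lemma split_point_of_convex_combination:
  fixes y a b t :: real
  assumes "1 \<le> y" "y \<le> (1 - t) * a + t * b" "0 \<le> t" "t \<le> 1" "1 \<le> a" "1 \<le> b"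
  shows "\<exists>u v. 1 \<le> u \<and> u \<le> a \<and> 1 \<le> v \<and> v \<le> b \<and> y = (1 - t) * u + t * v"
proof -
  define c where "c = (1 - t) * a + t * b"
  define s where "s = (y - 1) / (c - 1)"
  have c: "1 \<le> c" "y \<le> c" using assms by (auto simp: c_def)
  have s: "0 \<le> s" "s \<le> 1" "s * (c - 1) = y - 1"
    using c assms by (auto simp: s_def divide_simps)
  have "s * (a - 1) \<le> 1 * (a - 1)" "s * (b - 1) \<le> 1 * (b - 1)"
    using s assms by (intro mult_right_mono; simp)+
  moreover have "0 \<le> s * (a - 1)" "0 \<le> s * (b - 1)" using s assms by auto
  moreover have "y = (1 - t) * (1 + s * (a - 1)) + t * (1 + s * (b - 1))"
    using s(3) unfolding c_def by (simp add: algebra_simps)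
  ultimately show ?thesis by (intro exI[of _ "1 + s * (a - 1)"] exI[of _ "1 + s * (b - 1)"]) auto
qed

text \<open>
  Let \<open>S m \<le> h \<le> S (Suc m)\<close> and \<open>h = (1 - t) * S m + t * S (Suc m)\<close>. Removing the entry \<open>m\<close> or the
  entry \<open>Suc m\<close> from \<open>S\<close> gives sequences that differ only at \<open>m\<close>, and \<open>slice S h\<close> is their convex
  combination with weights \<open>1 - t\<close> and \<open>t\<close>. So \<open>y\<close> splits accordingly into \<open>u\<close> and \<open>v\<close>, which are
  extended by \<open>S m\<close> and by \<open>S (Suc m)\<close>. Below \<open>S 0\<close> no such \<open>m\<close> exists, but then \<open>h\<close> itself fits
  under the smallest bound.
\<close>

lemma permuted_boxes_slice_subset_layer:
  assumes mono: "mono_on {..<Suc n} S" and ge: "\<And>i. i < Suc n \<Longrightarrow> 1 \<le> S i"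
    and h: "1 \<le> h" "h \<le> S n"
  shows "permuted_boxes n (slice S h) \<subseteq> layer (Suc n) (convex hull (permuted_boxes (Suc n) S)) h"
proof
  fix y assume y: "y \<in> permuted_boxes n (slice S h)"
  have mS: "S i \<le> S j" if "i \<le> j" "j \<le> n" for i j
    using mono that by (auto simp: mono_on_def)
  have "Poly_Mapping.update n h y \<in> convex hull (permuted_boxes (Suc n) S)"
  proof (cases "h \<le> S 0")
    case True
    have "slice S h i = S (skip 0 i)" if "i < n" for i
      using True mS[of 0 i] mS[of 0 "Suc i"] that by (simp add: slice_def skip_def)
    then have "y \<in> permuted_boxes n (\<lambda>j. S (skip 0 j))"
      using y permuted_boxes_cong[of n "slice S h" "\<lambda>j. S (skip 0 j)"] by auto
    then show ?thesis
      using True h by (intro hull_inc update_in_permuted_boxes) auto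
  next
    case False
    define m where "m = (LEAST k. h \<le> S (Suc k))"
    have n: "n \<noteq> 0" using False h by (metis)
    then have ex: "h \<le> S (Suc (n - 1))" using h by simp
    have hm: "h \<le> S (Suc m)" unfolding m_def using ex by (rule LeastI)
    have mn: "m < n" using Least_le[of "\<lambda>k. h \<le> S (Suc k)", OF ex] n by (simp add: m_def)
    have mh: "S m \<le> h"
    proof (cases m)
      case 0
      then show ?thesis using False by simp
    next
      case (Suc k)
      then show ?thesis using not_less_Least[of k "\<lambda>k. h \<le> S (Suc k)"] by (simp add: m_def)
    qed
    obtain t where t: "0 \<le> t" "t \<le> 1" "h = (1 - t) * S m + t * S (Suc m)"
      using between_convex_combination[OF mh hm] by blast
    have slice: "slice S h i = (1 - t) * S (skip m i) + t * S (skip (Suc m) i)" if i: "i < n" for i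
    proof -
      consider "i < m" | "i = m" | "m < i" by linarith
      then show ?thesis
      proof cases
        case 1
        then have "S (Suc i) \<le> h" "S i \<le> h" using mS[of "Suc i" m] mS[of i m] mh mn by auto
        then show ?thesis using 1 by (simp add: slice_def skip_def algebra_simps)
      next
        case 2
        then show ?thesis using hm mh t(3) by (simp add: slice_def skip_def algebra_simps)
      next
        case 3
        then have "h \<le> S (Suc i)" "h \<le> S i" using mS[of "Suc m" "Suc i"] mS[of "Suc m" i] hm i by auto
        then show ?thesis using 3 by (simp add: slice_def skip_def algebra_simps)
      qed
    qed
    obtain \<sigma> where inj: "inj_on \<sigma> {..<n}" and ys: "y \<in> real_space n"
      and \<sigma>: "\<And>i. i < n \<Longrightarrow> \<sigma> i < n \<and> 1 \<le> Poly_Mapping.lookup y i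
          \<and> Poly_Mapping.lookup y i \<le> slice S h (\<sigma> i)"
      using y by (auto simp: permuted_boxes_def)
    have "\<exists>u v. 1 \<le> u \<and> u \<le> S (skip m (\<sigma> i)) \<and> 1 \<le> v \<and> v \<le> S (skip (Suc m) (\<sigma> i))
        \<and> Poly_Mapping.lookup y i = (1 - t) * u + t * v" if i: "i < n" for i
    proof (rule split_point_of_convex_combination)
      show "1 \<le> S (skip m (\<sigma> i))" "1 \<le> S (skip (Suc m) (\<sigma> i))"
        using ge \<sigma>[OF i] by (auto simp: skip_def)
    qed (use slice \<sigma>[OF i] t in auto)
    then obtain u v where uv: "\<And>i. i < n \<Longrightarrow> 1 \<le> u i \<and> u i \<le> S (skip m (\<sigma> i)) \<and> 1 \<le> v i
        \<and> v i \<le> S (skip (Suc m) (\<sigma> i)) \<and> Poly_Mapping.lookup y i = (1 - t) * u i + t * v i"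
      by metis
    have "point n u \<in> permuted_boxes n (\<lambda>j. S (skip m j))"
      "point n v \<in> permuted_boxes n (\<lambda>j. S (skip (Suc m) j))"
      using inj \<sigma> uv by (auto simp: permuted_boxes_def lookup_point point_in_real_space)
    then have "Poly_Mapping.update n (S m) (point n u) \<in> permuted_boxes (Suc n) S"
      "Poly_Mapping.update n (S (Suc m)) (point n v) \<in> permuted_boxes (Suc n) S"
      using mn ge by (auto intro!: update_in_permuted_boxes)
    then have "(1 - t) *\<^sub>R Poly_Mapping.update n (S m) (point n u)
        + t *\<^sub>R Poly_Mapping.update n (S (Suc m)) (point n v) \<in> convex hull (permuted_boxes (Suc n) S)"
      using t by (intro convexD_alt[OF convex_convex_hull] hull_inc)
    also have "(1 - t) *\<^sub>R Poly_Mapping.update n (S m) (point n u)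
        + t *\<^sub>R Poly_Mapping.update n (S (Suc m)) (point n v) = Poly_Mapping.update n h y"
      using ys uv t(3) by (intro poly_mapping_eqI)
        (auto simp: lookup_update lookup_add lookup_scaleR lookup_point real_space_iff)
    finally show ?thesis .
  qed
  then show "y \<in> layer (Suc n) (convex hull (permuted_boxes (Suc n) S)) h"
    using y by (auto simp: layer_def permuted_boxes_def)
qed

lemma hull_permuted_boxes_slice_subset_layer:
  assumes "mono_on {..<Suc n} S" "\<And>i. i < Suc n \<Longrightarrow> 1 \<le> S i" "1 \<le> h" "h \<le> S n"
  shows "convex hull (permuted_boxes n (slice S h))
    \<subseteq> layer (Suc n) (convex hull (permuted_boxes (Suc n) S)) h"
  by (intro hull_minimal permuted_boxes_slice_subset_layer convex_layer convex_convex_hull assms)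

text \<open>
  Induction on the dimension replaces the study of the vertices of the inequality system: a point is
  cut by the layer at its own last coordinate, which is a real number even when \<open>S\<close> is integral.
\<close>

lemma hull_permuted_boxes:
  assumes "mono_on {..<n} S" "\<And>i. i < n \<Longrightarrow> 1 \<le> S i"
  shows "convex hull (permuted_boxes n S) = subset_sum_polytope n S"
proof
  show "subset_sum_polytope n S \<subseteq> convex hull (permuted_boxes n S)"
    using assms
  proof (induction n arbitrary: S)
    case 0
    have "subset_sum_polytope 0 S \<subseteq> permuted_boxes 0 S"
      by (auto simp: subset_sum_polytope_def permuted_boxes_def)
    then show ?case
      using hull_subset by (rule order_trans)
  next
    case (Suc n)
    show ?case
    proof
      fix x assume x: "x \<in> subset_sum_polytope (Suc n) S"
      define h where "h = Poly_Mapping.lookup x n"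
      define x' where "x' = Poly_Mapping.update n 0 x"
      have xs: "x \<in> real_space (Suc n)" and h1: "1 \<le> h"
        using x by (auto simp: subset_sum_polytope_def h_def)
      have hS: "h \<le> S n"
      proof -
        have "sum (Poly_Mapping.lookup x) {n} \<le> sum S {Suc n - card {n}..<Suc n}"
          using x unfolding subset_sum_polytope_def by blast
        then show ?thesis by (simp add: h_def)
      qed
      have "x' \<in> layer (Suc n) (subset_sum_polytope (Suc n) S) h"
        unfolding x'_def h_def by (rule update_lookup_in_layer[OF xs x])
      then have "x' \<in> subset_sum_polytope n (slice S h)"
        using layer_subset_sum_polytope[of h S n] hS by blast
      also have "\<dots> \<subseteq> convex hull (permuted_boxes n (slice S h))"
        using Suc.prems(2) h1 by (intro Suc.IH mono_on_slice[OF Suc.prems(1)] slice_ge_one) auto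
      also have "\<dots> \<subseteq> layer (Suc n) (convex hull (permuted_boxes (Suc n) S)) h"
        by (rule hull_permuted_boxes_slice_subset_layer[OF Suc.prems h1 hS])
      finally have "Poly_Mapping.update n h x' \<in> convex hull (permuted_boxes (Suc n) S)"
        by (simp add: layer_def)
      also have "Poly_Mapping.update n h x' = x"
        by (rule poly_mapping_eqI) (simp add: lookup_update x'_def h_def)
      finally show "x \<in> convex hull (permuted_boxes (Suc n) S)" .
    qed
  qed
qed (rule hull_permuted_boxes_subset[OF assms(1)])

lemma layer_hull_permuted_boxes:
  assumes mono: "mono_on {..<Suc n} S" and ge: "\<And>i. i < Suc n \<Longrightarrow> 1 \<le> S i"
    and h: "1 \<le> h" "h \<le> S n"
  shows "layer (Suc n) (convex hull (permuted_boxes (Suc n) S)) h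
    = convex hull (permuted_boxes n (slice S h))"
proof
  have "convex hull (permuted_boxes n (slice S h)) = subset_sum_polytope n (slice S h)"
    using ge h by (intro hull_permuted_boxes mono_on_slice mono slice_ge_one) auto
  then show "layer (Suc n) (convex hull (permuted_boxes (Suc n) S)) h
      \<subseteq> convex hull (permuted_boxes n (slice S h))"
    using layer_subset_sum_polytope[of h S n] h hull_permuted_boxes[OF mono ge] by simp
qed (rule hull_permuted_boxes_slice_subset_layer[OF assms])

section \<open>Parking functions as lattice points of permuted boxes\<close>

lemma sort_eq_nth_permutation:
  fixes xs :: "'a :: linorder list"
  obtains f where "bij_betw f {..<length xs} {..<length xs}"
    "\<And>i. i < length xs \<Longrightarrow> sort xs ! i = xs ! f i"
  using permutation_Ex_bij[of "sort xs" xs] by auto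

text \<open>
  The entries at the positions from \<open>i\<close> on in the sorted list have bounds \<open>T (\<sigma> _)\<close> with distinct indices. There
  are too many of these for all to exceed \<open>i\<close>, so one of these entries is at most \<open>T i\<close>, and
  the entry at position \<open>i\<close> is no larger.
\<close>

lemma sort_nth_le:
  fixes xs :: "'a :: linorder list"
  assumes mono: "mono_on {..<length xs} T" and inj: "inj_on \<sigma> {..<length xs}"
    and \<sigma>: "\<And>i. i < length xs \<Longrightarrow> \<sigma> i < length xs \<and> xs ! i \<le> T (\<sigma> i)"
    and i: "i < length xs"
  shows "sort xs ! i \<le> T i"
proof -
  obtain f where f: "bij_betw f {..<length xs} {..<length xs}"
    "\<And>i. i < length xs \<Longrightarrow> sort xs ! i = xs ! f i"
    using sort_eq_nth_permutation by blast
  have flt: "f j < length xs" if "j < length xs" for j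
    using f(1) that by (auto simp: bij_betw_def)
  have "inj_on (\<sigma> \<circ> f) {..<length xs}"
    using f(1) inj by (intro comp_inj_on) (auto simp: bij_betw_def)
  then have injf: "inj_on (\<sigma> \<circ> f) {i..<length xs}"
    by (rule inj_on_subset) auto
  have "\<exists>j\<in>{i..<length xs}. \<sigma> (f j) \<le> i"
  proof (rule ccontr)
    assume none: "\<not> ?thesis"
    have "(\<sigma> \<circ> f) ` {i..<length xs} \<subseteq> {Suc i..<length xs}"
    proof (rule image_subsetI)
      fix j assume j: "j \<in> {i..<length xs}"
      then have "i < \<sigma> (f j)" using none by (meson not_less)
      moreover have "\<sigma> (f j) < length xs" using \<sigma> flt j by simp
      ultimately show "(\<sigma> \<circ> f) j \<in> {Suc i..<length xs}" by simp
    qed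
    from card_mono[OF _ this] have "length xs - i \<le> length xs - Suc i"
      unfolding card_image[OF injf] by simp
    then show False using i by linarith
  qed
  then obtain j where j: "i \<le> j" "j < length xs" "\<sigma> (f j) \<le> i" by auto
  have "sort xs ! i \<le> sort xs ! j" using j by (intro sorted_nth_mono) auto
  also have "\<dots> = xs ! f j" using f(2) j by simp
  also have "\<dots> \<le> T (\<sigma> (f j))" using \<sigma> flt j by simp
  also have "\<dots> \<le> T i" using mono i j by (auto simp: mono_on_def)
  finally show ?thesis .
qed

lemma partial_sum_Suc:
  "i < length b \<Longrightarrow> partial_sum b (Suc i) = partial_sum b i + b ! i"
  by (simp add: partial_sum_def take_Suc_conv_app_nth)

lemma partial_sum_Suc_pos:
  assumes "\<forall>x\<in>set b. 0 < x" "i < length b"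
  shows "0 < partial_sum b (Suc i)"
  using assms nth_mem[of i b] by (force simp: partial_sum_Suc)

lemma partial_sum_mono: "i \<le> j \<Longrightarrow> partial_sum b i \<le> partial_sum b j"
  unfolding partial_sum_def by (metis le_add1 le_add_diff_inverse sum_list_append take_add)

lemma parking_function_iff:
  "parking_function b \<beta> \<longleftrightarrow> length \<beta> = length b \<and> (\<forall>x\<in>set \<beta>. 0 < x) \<and>
     (\<forall>i<length b. sort \<beta> ! i \<le> partial_sum b (Suc i))"
proof -
  have "{1..length b} = Suc ` {..<length b}" by (simp add: image_Suc_lessThan)
  then show ?thesis by (auto simp: parking_function_def simp del: image_Suc_lessThan)
qed

text \<open>
  A sorting permutation places each parking function in a box. Conversely every box is the hull of its
  corners, whose coordinates \<open>1\<close> or $S_{\sigma(i)}$ are positive integers, and these corners are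
  parking functions by \<open>sort_nth_le\<close>.
\<close>

lemma parking_polytope_eq_hull_permuted_boxes:
  assumes pos: "\<forall>x\<in>set b. 0 < x"
  shows "parking_polytope b
    = convex hull (permuted_boxes (length b) (\<lambda>i. real (partial_sum b (Suc i))))"
    (is "_ = convex hull (permuted_boxes ?n ?S)")
proof -
  let ?PF = "{Poly_Mapping.nth (map real \<beta>) |\<beta>. parking_function b \<beta>}"
  have "?PF \<subseteq> permuted_boxes ?n ?S"
  proof clarify
    fix \<beta> assume "parking_function b \<beta>"
    then have len: "length \<beta> = ?n" and p: "\<forall>x\<in>set \<beta>. 0 < x"
      and le: "\<And>i. i < ?n \<Longrightarrow> sort \<beta> ! i \<le> partial_sum b (Suc i)"
      by (simp_all add: parking_function_iff)
    obtain f where f: "bij_betw f {..<?n} {..<?n}" "\<And>i. i < ?n \<Longrightarrow> sort \<beta> ! i = \<beta> ! f i"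
      using sort_eq_nth_permutation[of \<beta>] len by metis
    define g where "g = the_inv_into {..<?n} f"
    have g: "bij_betw g {..<?n} {..<?n}" unfolding g_def by (rule bij_betw_the_inv_into[OF f(1)])
    have fg: "g i < ?n" "f (g i) = i" if "i < ?n" for i
      using f(1) g that f_the_inv_into_f_bij_betw[OF f(1), of i] by (auto simp: g_def bij_betw_def)
    have "1 \<le> \<beta> ! i \<and> \<beta> ! i \<le> partial_sum b (Suc (g i))" if "i < ?n" for i
      using p len that f(2)[of "g i"] fg le[of "g i"] by (auto simp: Suc_le_eq)
    then have "\<exists>\<sigma>. inj_on \<sigma> {..<?n} \<and> (\<forall>i<?n. \<sigma> i < ?n
        \<and> 1 \<le> Poly_Mapping.lookup (Poly_Mapping.nth (map real \<beta>)) i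
        \<and> Poly_Mapping.lookup (Poly_Mapping.nth (map real \<beta>)) i \<le> ?S (\<sigma> i))"
      using g fg len by (intro exI[of _ g]) (auto simp: nth_default_def bij_betw_def)
    then show "Poly_Mapping.nth (map real \<beta>) \<in> permuted_boxes ?n ?S"
      using len by (auto simp: permuted_boxes_def real_space_iff nth_default_def)
  qed
  moreover have "permuted_boxes ?n ?S \<subseteq> convex hull ?PF"
  proof
    fix x assume "x \<in> permuted_boxes ?n ?S"
    then obtain \<sigma> where x: "x \<in> real_space ?n" and inj: "inj_on \<sigma> {..<?n}"
      and \<sigma>: "\<And>i. i < ?n \<Longrightarrow> \<sigma> i < ?n \<and> 1 \<le> Poly_Mapping.lookup x i
          \<and> Poly_Mapping.lookup x i \<le> ?S (\<sigma> i)"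
      by (auto simp: permuted_boxes_def)
    have "point ?n (Poly_Mapping.lookup x) \<in> convex hull ?PF"
    proof (rule box_subset_convex[where a = "\<lambda>_. 1" and b = "\<lambda>i. ?S (\<sigma> i)"])
      fix f :: "nat \<Rightarrow> real" assume f: "\<And>i. i < ?n \<Longrightarrow> f i = 1 \<or> f i = ?S (\<sigma> i)"
      define \<beta> where "\<beta> = map (\<lambda>i. nat \<lfloor>f i\<rfloor>) [0..<?n]"
      have len: "length \<beta> = ?n" by (simp add: \<beta>_def)
      have \<beta>: "\<beta> ! i = 1 \<or> \<beta> ! i = partial_sum b (Suc (\<sigma> i))" "real (\<beta> ! i) = f i"
        if "i < ?n" for i
        using f[OF that] that by (auto simp: \<beta>_def)
      have bnd: "0 < \<beta> ! i \<and> \<beta> ! i \<le> partial_sum b (Suc (\<sigma> i))" if "i < ?n" for i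
        using \<beta>(1)[OF that] partial_sum_Suc_pos[OF pos, of "\<sigma> i"] \<sigma>[OF that] by auto
      have "sort \<beta> ! i \<le> partial_sum b (Suc i)" if "i < ?n" for i
      proof (rule sort_nth_le[where \<sigma> = \<sigma>])
        show "mono_on {..<length \<beta>} (\<lambda>i. partial_sum b (Suc i))"
          by (auto simp: mono_on_def intro: partial_sum_mono)
      qed (use inj len that bnd \<sigma> in auto)
      moreover have "\<forall>x\<in>set \<beta>. 0 < x"
        using bnd len by (auto simp: in_set_conv_nth)
      ultimately have "parking_function b \<beta>"
        using len by (simp add: parking_function_iff)
      moreover have "point ?n f = Poly_Mapping.nth (map real \<beta>)"
        using len \<beta>(2) by (intro poly_mapping_eqI) (auto simp: lookup_point nth_default_def)
      ultimately show "point ?n f \<in> convex hull ?PF"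
        by (intro hull_inc) auto
    qed (use \<sigma> in auto)
    then show "x \<in> convex hull ?PF" using point_lookup[OF x] by simp
  qed
  ultimately show ?thesis
    unfolding parking_polytope_def
    by (intro subset_antisym hull_mono hull_minimal) (simp_all add: convex_convex_hull)
qed

section \<open>Partial sums of the reduced vector\<close>

lemma partial_sum_0 [simp]: "partial_sum b 0 = 0"
  by (simp add: partial_sum_def)

lemma partial_sum_Cons: "partial_sum (x # b) (Suc i) = x + partial_sum b i"
  by (simp add: partial_sum_def)

lemma partial_sum_append: "partial_sum (b @ c) i = partial_sum b i + partial_sum c (i - length b)"
  by (simp add: partial_sum_def)

lemma partial_sum_take: "partial_sum (take k b) i = partial_sum b (min i k)"
  by (simp add: partial_sum_def)

lemma partial_sum_add: "partial_sum b (i + j) = partial_sum b i + partial_sum (drop i b) j"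
  by (simp add: partial_sum_def take_add)

text \<open>
  For $1 < \ell < n$ the two middle entries $b_{\ell-1} + b_\ell - r$ and $b_{\ell+1} + r$ change
  only one partial sum besides the shift: the \<open>r\<close> missing from the first is restored by the second.
\<close>

lemma partial_sum_reduced_vector:
  assumes "height_decomposition b h l r" "Suc i < length b"
  shows "partial_sum (reduced_vector b l r) (Suc i)
    = (if Suc i < l - 1 then partial_sum b (Suc i)
       else if Suc i = l - 1 then partial_sum b l - r
       else partial_sum b (Suc (Suc i)))"
proof (cases "l = 1")
  case True
  have "partial_sum b 2 = b ! 0 + b ! 1"
    using assms(2) partial_sum_Suc[of 0 b] partial_sum_Suc[of 1 b]
    by (cases "b = []") (auto simp: numeral_2_eq_2)
  then show ?thesis
    using True partial_sum_add[of b 2 i] by (simp add: reduced_vector_def partial_sum_Cons)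
next
  case False
  from assms(1) have l: "1 \<le> l" "l \<le> length b" "r \<le> b ! (l - 1)"
    by (auto simp: height_decomposition_def)
  define p where "p = l - 2"
  have lp: "l = Suc (Suc p)" using l False by (simp add: p_def)
  define c where "c = (if l < length b then (b ! l + r) # drop (Suc l) b else [])"
  have red: "reduced_vector b l r = take p b @ (b ! p + b ! Suc p - r) # c"
  proof (cases "l < length b")
    case True
    then show ?thesis using lp by (simp add: reduced_vector_def c_def)
  next
    case False
    then have "length b = Suc (Suc p)" using l lp by simp
    then show ?thesis by (simp add: reduced_vector_def c_def lp)
  qed
  have Sl: "partial_sum b l = partial_sum b p + b ! p + b ! Suc p"
    using l lp by (simp add: partial_sum_Suc)
  have r: "r \<le> b ! Suc p" using l lp by simp
  have len: "length (take p b) = p" using l lp by simp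
  consider "Suc i \<le> p" | "i = p" | "Suc p \<le> i" by linarith
  then show ?thesis
  proof cases
    case 1
    then show ?thesis
      unfolding red by (simp add: partial_sum_append partial_sum_take len lp del: length_take)
  next
    case 2
    then show ?thesis
      unfolding red using Sl r
      by (simp add: partial_sum_append partial_sum_take partial_sum_Cons len lp del: length_take)
  next
    case 3
    then have lt: "l < length b" using assms(2) lp by simp
    define k where "k = i - Suc p"
    have i: "i = Suc (p + k)" using 3 by (simp add: k_def)
    have "partial_sum b (Suc (Suc i)) = partial_sum b (Suc l) + partial_sum (drop (Suc l) b) k"
      using partial_sum_add[of b "Suc l" k] by (simp add: i lp)
    moreover have "partial_sum b (Suc l) = partial_sum b l + b ! l"
      using lt by (rule partial_sum_Suc)
    ultimately show ?thesis
      unfolding red using Sl r lt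
      by (simp add: partial_sum_append partial_sum_take partial_sum_Cons len lp i c_def
          Suc_diff_le del: length_take)
  qed
qed

lemma height_decomposition_bounds:
  assumes "height_decomposition b h l r"
  shows "partial_sum b (l - 1) < h" "h \<le> partial_sum b l"
proof -
  have "partial_sum b l = partial_sum b (l - 1) + b ! (l - 1)"
    using assms partial_sum_Suc[of "l - 1" b] by (auto simp: height_decomposition_def)
  then show "partial_sum b (l - 1) < h" "h \<le> partial_sum b l"
    using assms by (auto simp: height_decomposition_def)
qed

lemma partial_sum_reduced_vector_eq_slice:
  assumes hd: "height_decomposition b h l r" and i: "Suc i < length b"
  shows "real (partial_sum (reduced_vector b l r) (Suc i))
    = slice (\<lambda>i. real (partial_sum b (Suc i))) (real h) i"
proof -
  note bounds = height_decomposition_bounds[OF hd]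
  have h: "h = partial_sum b (l - 1) + r" using hd by (simp add: height_decomposition_def)
  consider "Suc i < l - 1" | "Suc i = l - 1" | "l \<le> Suc i" by linarith
  then show ?thesis
  proof cases
    case 1
    have "partial_sum b (Suc i) \<le> h" "partial_sum b (Suc (Suc i)) \<le> h"
      using 1 bounds partial_sum_mono[of "Suc i" "l - 1" b] partial_sum_mono[of "Suc (Suc i)" "l - 1" b]
      by auto
    then show ?thesis
      using 1 partial_sum_reduced_vector[OF hd i] by (simp add: slice_def)
  next
    case 2
    then have l: "l = Suc (Suc i)" by simp
    have "partial_sum (reduced_vector b l r) (Suc i) = partial_sum b (Suc (Suc i)) - r"
      using partial_sum_reduced_vector[OF hd i] l by simp
    moreover have "h = partial_sum b (Suc i) + r" "h \<le> partial_sum b (Suc (Suc i))"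
      using h bounds l by simp_all
    ultimately show ?thesis
      by (simp add: slice_def of_nat_diff)
  next
    case 3
    then have late: "\<not> Suc i < l - 1" "Suc i \<noteq> l - 1" by linarith+
    have "h \<le> partial_sum b (Suc i)" "h \<le> partial_sum b (Suc (Suc i))"
      using 3 bounds partial_sum_mono[of l "Suc i" b] partial_sum_mono[of l "Suc (Suc i)" b]
      by auto
    then show ?thesis
      using partial_sum_reduced_vector[OF hd i] late by (simp add: slice_def)
  qed
qed

lemma length_reduced_vector:
  assumes "height_decomposition b h l r" "2 \<le> length b"
  shows "length (reduced_vector b l r) = length b - 1"
  using assms by (auto simp: reduced_vector_def height_decomposition_def Let_def)

lemma reduced_vector_pos:
  assumes hd: "height_decomposition b h l r" and len: "2 \<le> length b" and pos: "\<forall>x\<in>set b. 0 < x"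
  shows "\<forall>x\<in>set (reduced_vector b l r). 0 < x"
proof -
  have nth: "0 < b ! i" if "i < length b" for i
    using pos that nth_mem by blast
  have "set (take k b) \<subseteq> set b" "set (drop k b) \<subseteq> set b" for k
    by (simp_all add: set_take_subset set_drop_subset)
  then have sub: "0 < x" if "x \<in> set (take k b) \<or> x \<in> set (drop k b)" for x k
    using pos that by blast
  have "1 < l \<Longrightarrow> 0 < b ! (l - 2)" "r \<le> b ! (l - 1)"
    using hd nth[of "l - 2"] by (auto simp: height_decomposition_def)
  moreover have "1 \<le> l" "l \<le> length b" "1 \<le> r" using hd by (auto simp: height_decomposition_def)
  moreover have "0 < b ! 0" using nth[of 0] len by (cases "b = []") auto
  ultimately show ?thesis
    using sub by (auto simp: reduced_vector_def Let_def not_less le_antisym)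
qed

lemma height_decomposition_unique:
  assumes "height_decomposition b h l r" "height_decomposition b h l' r'"
  shows "l = l'" "r = r'"
proof -
  note b1 = height_decomposition_bounds[OF assms(1)] and b2 = height_decomposition_bounds[OF assms(2)]
  have "\<not> l < l'" using b1 b2 partial_sum_mono[of l "l' - 1" b] by fastforce
  moreover have "\<not> l' < l" using b1 b2 partial_sum_mono[of l' "l - 1" b] by fastforce
  ultimately show l: "l = l'" by simp
  show "r = r'" using assms l by (simp add: height_decomposition_def)
qed

lemma height_decomposition_exists:
  assumes "1 \<le> h" "h \<le> partial_sum b (length b)"
  shows "\<exists>l r. height_decomposition b h l r"
proof -
  define l where "l = (LEAST k. h \<le> partial_sum b k)"
  have le: "h \<le> partial_sum b l" unfolding l_def using assms(2) by (rule LeastI)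
  have ln: "l \<le> length b" unfolding l_def using assms(2) by (rule Least_le)
  have "l \<noteq> 0" using le assms(1) by (metis not_one_le_zero order_trans partial_sum_0)
  then have l: "1 \<le> l" "l - 1 < l" by auto
  then have lt: "partial_sum b (l - 1) < h"
    using not_less_Least[of "l - 1" "\<lambda>k. h \<le> partial_sum b k"] by (simp add: l_def)
  have "partial_sum b l = partial_sum b (l - 1) + b ! (l - 1)"
    using l ln partial_sum_Suc[of "l - 1" b] by simp
  then have "height_decomposition b h l (h - partial_sum b (l - 1))"
    using l ln lt le by (auto simp: height_decomposition_def)
  then show ?thesis by blast
qed

theorem theorem3p5:
  fixes n h :: nat and b :: "nat list"
  assumes "2 \<le> n"
    and "length b = n"
    and "\<forall>x\<in>set b. 0 < x"
    and "1 \<le> h" and "h \<le> partial_sum b n"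
  shows "(\<exists>!(l, r). height_decomposition b h l r) \<and>
    (\<forall>l r. height_decomposition b h l r \<longrightarrow>
       (partial_sum b (l - 1) < h \<and> h \<le> partial_sum b l) \<and>
       length (reduced_vector b l r) = n - 1 \<and>
       (\<forall>x\<in>set (reduced_vector b l r). 0 < x) \<and>
       layer n (parking_polytope b) (real h) = parking_polytope (reduced_vector b l r))"
proof (intro conjI allI impI)
  obtain l r where "height_decomposition b h l r"
    using height_decomposition_exists assms by blast
  then show "\<exists>!(l, r). height_decomposition b h l r"
    by (auto intro!: ex1I[of _ "(l, r)"] dest: height_decomposition_unique)
next
  fix l r assume hd: "height_decomposition b h l r"
  show "partial_sum b (l - 1) < h" "h \<le> partial_sum b l"
    by (fact height_decomposition_bounds[OF hd])+
  have len: "2 \<le> length b" using assms by simp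
  show lenr: "length (reduced_vector b l r) = n - 1"
    using length_reduced_vector[OF hd len] assms by simp
  show posr: "\<forall>x\<in>set (reduced_vector b l r). 0 < x"
    by (rule reduced_vector_pos[OF hd len assms(3)])
  define S where "S i = real (partial_sum b (Suc i))" for i
  have n: "n = Suc (n - 1)" using assms(1) by simp
  have mono: "mono_on {..<Suc (n - 1)} S"
    by (auto simp: S_def mono_on_def intro: partial_sum_mono)
  have ge: "1 \<le> S i" if "i < Suc (n - 1)" for i
    using partial_sum_Suc_pos[OF assms(3), of i] assms(2) that n by (simp add: S_def Suc_le_eq)
  have hS: "1 \<le> real h" "real h \<le> S (n - 1)" using assms n by (auto simp: S_def)
  have "layer n (parking_polytope b) (real h)
      = layer (Suc (n - 1)) (convex hull (permuted_boxes (Suc (n - 1)) S)) (real h)"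
    using parking_polytope_eq_hull_permuted_boxes[OF assms(3)] assms(2) n
    by (simp add: S_def[abs_def])
  also have "\<dots> = convex hull (permuted_boxes (n - 1) (slice S (real h)))"
    by (rule layer_hull_permuted_boxes[OF mono ge hS])
  also have "permuted_boxes (n - 1) (slice S (real h))
      = permuted_boxes (n - 1) (\<lambda>i. real (partial_sum (reduced_vector b l r) (Suc i)))"
  proof (rule permuted_boxes_cong)
    fix i assume "i < n - 1"
    then show "slice S (real h) i = real (partial_sum (reduced_vector b l r) (Suc i))"
      using partial_sum_reduced_vector_eq_slice[OF hd, of i] assms by (simp add: S_def[abs_def])
  qed
  also have "convex hull \<dots> = parking_polytope (reduced_vector b l r)"
    using parking_polytope_eq_hull_permuted_boxes[OF posr] lenr by simp
  finally show "layer n (parking_polytope b) (real h) = parking_polytope (reduced_vector b l r)" .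
qed

end
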